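(* Let $k \geq 2$ be an integer and let $G$ be a graph on $n \geq 2^{2k}$ vertices. Then $G$ contains no even $k$-vertex subgraph if and only if $\binom{k}{2}$ is odd and at least one of the following holds: 1. $G$ is a clique; 2. $k \equiv 3 \pmod 4$ and $G$ is the disjoint union of two cliques.
   Context: All graphs are finite and simple. An even $k$-vertex subgraph of $G$ is an induced subgraph $G[U]$, with $U\subseteq V(G)$ and $|U|=k$, having an even number of edges. "$G$ is a clique" means $G$ is a complete graph. "$G$ is the disjoint union of two cliques" means $V(G)$ can be partitioned into two sets, each inducing a complete graph, with no edges of $G$ between them. *)

theory Defs
  imports Main "HOL-Library.Ramsey"
begin

text \<open>
  A graph is given by a vertex set \<open>V\<close> and a set \<open>E\<close> of two-element subsets of \<open>V\<close>;
  \<open>[A]\<^bsup>m\<^esup>\<close> (\<open>nsets A m\<close>) is the library notation for the set of \<open>m\<close>-element subsets of \<open>A\<close>.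
\<close>

definition finite_simple_graph :: "'a set \<Rightarrow> 'a set set \<Rightarrow> bool" where
  "finite_simple_graph V E \<longleftrightarrow> finite V \<and> E \<subseteq> [V]\<^bsup>2\<^esup>"

definition induced_edges :: "'a set set \<Rightarrow> 'a set \<Rightarrow> 'a set set" where
  "induced_edges E U = {e \<in> E. e \<subseteq> U}"

definition complete_graph :: "'a set \<Rightarrow> 'a set set \<Rightarrow> bool" where
  "complete_graph V E \<longleftrightarrow> E = [V]\<^bsup>2\<^esup>"

definition has_even_induced_subgraph :: "'a set \<Rightarrow> 'a set set \<Rightarrow> nat \<Rightarrow> bool" where
  "has_even_induced_subgraph V E k \<longleftrightarrow> (\<exists>U \<subseteq> V. card U = k \<and> even (card (induced_edges E U)))"

text \<open>
  An empty part is allowed, so a complete graph also satisfies this predicate.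
\<close>

definition disjoint_union_of_two_cliques :: "'a set \<Rightarrow> 'a set set \<Rightarrow> bool" where
  "disjoint_union_of_two_cliques V E \<longleftrightarrow>
     (\<exists>A B. A \<union> B = V \<and> A \<inter> B = {} \<and>
        complete_graph A (induced_edges E A) \<and> complete_graph B (induced_edges E B) \<and>
        (\<forall>a\<in>A. \<forall>b\<in>B. {a, b} \<notin> E))"

end

theory Submission
  imports Defs
begin

text \<open>
  Write \<open>a(x,y)\<close> for the adjacency indicator modulo 2, and suppose that every \<open>k\<close>-set spans an
  odd number of edges. Exchanging one vertex of a \<open>k\<close>-set preserves the parity, so all vertices
  outside a \<open>(k-1)\<close>-set \<open>W\<close> have the same parity of degree into \<open>W\<close>. Exchanging a vertex of
  \<open>W\<close> in turn gives \<open>a(x,w) + a(x,w') + a(y,w) + a(y,w') = 0\<close>, that is, every 4-cycle of the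
  complete graph on \<open>V\<close> carries an even number of edges (\<open>even_four_cycles\<close>). Two triangles with
  a common side differ by a 4-cycle, so all triangles through a fixed vertex have the same parity.
  Hence the graph is a disjoint union of two cliques (odd triangles) or a complete bipartite graph
  (even triangles), possibly with an empty part; this is \<open>dichotomy\<close>. The parts are the
  neighbourhood of the fixed vertex and its complement, with the fixed vertex itself added to its
  neighbours in the first case and to its non-neighbours in the second.

  Since there are at least \<open>2 * k\<close> vertices, one of the two parts has at least \<open>k\<close> of them. In the bipartite case it contains \<open>k\<close>
  independent vertices, which span the even number 0 of edges. In the other case \<open>k\<close> of its
  vertices span \<open>k choose 2\<close> edges, so this number is odd; and if both parts are
  nonempty, \<open>k-1\<close> of its vertices together with one vertex of the other part span
  \<open>(k-1) choose 2\<close> edges, so this is odd too, which forces \<open>k mod 4 = 3\<close>. Conversely, a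
  \<open>k\<close>-set meeting the two cliques in \<open>p\<close> and \<open>q\<close> vertices spans \<open>(k choose 2) - p * q\<close> edges,
  and \<open>p * q\<close> is even when \<open>p + q = k\<close> is odd.
\<close>

section \<open>Counting induced edges\<close>

lemma finite_induced_edges: "finite U \<Longrightarrow> finite (induced_edges E U)"
  by (rule finite_subset[of _ "Pow U"]) (auto simp: induced_edges_def)

lemma card_induced_edges_insert:
  assumes E: "E \<subseteq> [V]\<^bsup>2\<^esup>" and W: "finite W" "x \<notin> W"
  shows "card (induced_edges E (insert x W)) =
    card (induced_edges E W) + card {w \<in> W. {x, w} \<in> E}"
proof -
  have edge: "\<exists>u v. e = {u, v} \<and> u \<noteq> v" if "e \<in> E" for e
    using that E by (auto simp: nsets_def card_2_iff)
  have split: "induced_edges E (insert x W) =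
      induced_edges E W \<union> (\<lambda>w. {x, w}) ` {w \<in> W. {x, w} \<in> E}" (is "_ = _ \<union> ?N")
    using edge by (fastforce simp: induced_edges_def insert_commute)
  have "inj_on (\<lambda>w. {x, w}) {w \<in> W. {x, w} \<in> E}"
    by (auto simp: inj_on_def doubleton_eq_iff)
  then have "card ?N = card {w \<in> W. {x, w} \<in> E}"
    by (rule card_image)
  moreover have "induced_edges E W \<inter> ?N = {}"
    using W by (auto simp: induced_edges_def)
  ultimately show ?thesis
    using W by (simp add: split card_Un_disjoint finite_induced_edges)
qed

lemma card_induced_edges_clique:
  assumes "complete_graph A (induced_edges E A)" "U \<subseteq> A"
  shows "card (induced_edges E U) = card U choose 2"
proof -
  have "induced_edges E U = [U]\<^bsup>2\<^esup>"
    using assms by (auto simp: complete_graph_def induced_edges_def nsets_def)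
  then show ?thesis
    by simp
qed

lemma card_induced_edges_two_cliques:
  assumes E: "E \<subseteq> [V]\<^bsup>2\<^esup>"
    and A: "complete_graph A (induced_edges E A)" "P \<subseteq> A" "finite P"
    and B: "complete_graph B (induced_edges E B)" "Q \<subseteq> B" "finite Q"
    and AB: "A \<inter> B = {}" "\<And>a b. a \<in> A \<Longrightarrow> b \<in> B \<Longrightarrow> {a, b} \<notin> E"
  shows "card (induced_edges E (P \<union> Q)) = (card P choose 2) + (card Q choose 2)"
proof -
  have edge: "\<exists>u v. e = {u, v} \<and> u \<noteq> v" if "e \<in> E" for e
    using that E by (auto simp: nsets_def card_2_iff)
  have "induced_edges E (P \<union> Q) = induced_edges E P \<union> induced_edges E Q"
  proof
    show "induced_edges E (P \<union> Q) \<subseteq> induced_edges E P \<union> induced_edges E Q"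
    proof
      fix e assume "e \<in> induced_edges E (P \<union> Q)"
      then have e: "e \<in> E" "e \<subseteq> P \<union> Q"
        by (auto simp: induced_edges_def)
      then obtain u v where uv: "e = {u, v}"
        using edge by blast
      have "\<not> (u \<in> P \<and> v \<in> Q)" "\<not> (v \<in> P \<and> u \<in> Q)"
        using AB(2)[of u v] AB(2)[of v u] A(2) B(2) e(1) uv by (auto simp: insert_commute)
      then show "e \<in> induced_edges E P \<union> induced_edges E Q"
        using e uv by (auto simp: induced_edges_def)
    qed
  qed (auto simp: induced_edges_def)
  moreover have "induced_edges E P \<inter> induced_edges E Q = {}"
    using edge AB(1) A(2) B(2) by (fastforce simp: induced_edges_def)
  ultimately show ?thesis
    using A B by (simp add: card_Un_disjoint finite_induced_edges
        card_induced_edges_clique[of A] card_induced_edges_clique[of B])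
qed

lemma choose_two_add: "(p + q) choose 2 = (p choose 2) + (q choose 2) + p * q"
  by (induction p) (auto simp: numeral_2_eq_2)

lemma no_even_induced_subgraphD:
  assumes "\<not> has_even_induced_subgraph V E k" "U \<subseteq> V" "card U = k"
  shows "odd (card (induced_edges E U))"
  using assms by (auto simp: has_even_induced_subgraph_def)

section \<open>The structure of graphs all of whose \<open>k\<close>-sets are odd\<close>

text \<open>
  The equivalence in the conclusion says that the 4-cycle \<open>x w y w'\<close> has an even number of edges.
  The \<open>k-2\<close> further vertices \<open>S\<close> pad the four \<open>k\<close>-sets obtained by adding one of \<open>x, y\<close> and
  one of \<open>w, w'\<close>; when the four parities are added, everything except the 4-cycle cancels.
\<close>
lemma even_four_cycles:
  assumes E: "E \<subseteq> [V]\<^bsup>2\<^esup>" and V: "finite V" "card V \<ge> k + 2" and k: "k \<ge> 2"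
    and odd: "\<not> has_even_induced_subgraph V E k"
    and xyw: "x \<in> V" "y \<in> V" "w \<in> V" "w' \<in> V" "distinct [x, y, w, w']"
  shows "({x, w} \<in> E \<longleftrightarrow> {x, w'} \<in> E) \<longleftrightarrow> ({y, w} \<in> E \<longleftrightarrow> {y, w'} \<in> E)"
proof -
  have "card (V - {x, y, w, w'}) = card V - 4"
    using V xyw by (subst card_Diff_subset) auto
  then have "k - 2 \<le> card (V - {x, y, w, w'})"
    using V by simp
  then obtain S where S: "S \<subseteq> V - {x, y, w, w'}" "card S = k - 2" "finite S"
    by (rule obtain_subset_with_card_n)
  let ?e = "\<lambda>U. card (induced_edges E U)" and ?d = "\<lambda>x W. card {w \<in> W. {x, w} \<in> E}"
  have parity: "odd (?e (insert u (insert v S)))"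
    if "u \<in> V" "v \<in> V" "u \<notin> S" "v \<notin> S" "u \<noteq> v" for u v
  proof -
    have "card (insert u (insert v S)) = k"
      using that S k by simp
    then show ?thesis
      using that S by (intro no_even_induced_subgraphD[OF odd]) auto
  qed
  have count: "even (?e (insert u (insert v S))) \<longleftrightarrow>
      (even (?e S) \<longleftrightarrow> (even (?d v S) \<longleftrightarrow> (even (?d u S) \<longleftrightarrow> {u, v} \<notin> E)))"
    if "u \<notin> S" "v \<notin> S" "u \<noteq> v" for u v
  proof -
    have "{z \<in> insert v S. {u, z} \<in> E} =
        (if {u, v} \<in> E then insert v {z \<in> S. {u, z} \<in> E} else {z \<in> S. {u, z} \<in> E})"
      by auto
    then have "?d u (insert v S) = ?d u S + (if {u, v} \<in> E then 1 else 0)"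
      using that S by simp
    moreover have "?e (insert u (insert v S)) = ?e S + ?d v S + ?d u (insert v S)"
      using that S by (simp add: card_induced_edges_insert[OF E])
    ultimately show ?thesis
      by simp argo
  qed
  have outside: "x \<notin> S" "y \<notin> S" "w \<notin> S" "w' \<notin> S"
    using S by auto
  then have "odd (?e (insert x (insert w S)))" "odd (?e (insert x (insert w' S)))"
    "odd (?e (insert y (insert w S)))" "odd (?e (insert y (insert w' S)))"
    using xyw by (simp_all add: parity)
  with xyw outside count[of x w] count[of x w'] count[of y w] count[of y w']
  show ?thesis
    by simp argo
qed

text \<open>
  The flag \<open>c\<close> records the common parity of the triangles through a fixed vertex: for \<open>c\<close> true the
  graph is a disjoint union of two cliques with vertex sets \<open>A\<close> and \<open>V - A\<close>, for \<open>c\<close> false it is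
  complete bipartite with these parts.
\<close>
lemma dichotomy:
  assumes E: "E \<subseteq> [V]\<^bsup>2\<^esup>" and V: "finite V" "card V \<ge> k + 2" and k: "k \<ge> 2"
    and odd: "\<not> has_even_induced_subgraph V E k"
  obtains A c where "A \<subseteq> V"
    "\<And>x y. x \<in> V \<Longrightarrow> y \<in> V \<Longrightarrow> x \<noteq> y \<Longrightarrow> {x, y} \<in> E \<longleftrightarrow> ((x \<in> A \<longleftrightarrow> y \<in> A) \<longleftrightarrow> c)"
proof -
  obtain T where T: "T \<subseteq> V" "card T = 3"
    using V k obtain_subset_with_card_n[of 3 V] by auto
  then obtain v a b where vab: "v \<in> V" "a \<in> V" "b \<in> V" "distinct [v, a, b]"
    by (auto simp: card_3_iff)
  \<comment> \<open>\<open>t x y\<close> says that the triangle \<open>v x y\<close> has an odd number of edges.\<close>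
  define t where "t x y \<longleftrightarrow> ({v, x} \<in> E \<longleftrightarrow> ({v, y} \<in> E \<longleftrightarrow> {x, y} \<in> E))" for x y
  have t_sym: "t x y \<longleftrightarrow> t y x" for x y
    by (auto simp: t_def insert_commute)
  have t_side: "t x y \<longleftrightarrow> t x z"
    if "x \<in> V - {v}" "y \<in> V - {v}" "z \<in> V - {v}" "x \<noteq> y" "x \<noteq> z" for x y z
  proof (cases "y = z")
    case False
    then have "({v, y} \<in> E \<longleftrightarrow> {v, z} \<in> E) \<longleftrightarrow> ({x, y} \<in> E \<longleftrightarrow> {x, z} \<in> E)"
      using that vab by (intro even_four_cycles[OF assms]) auto
    then show ?thesis
      unfolding t_def by argo
  qed simp
  have t_const: "t x y \<longleftrightarrow> t a b" if "x \<in> V - {v}" "y \<in> V - {v}" "x \<noteq> y" for x y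
  proof (cases "x = b")
    case True
    then show ?thesis
      using t_side[of b y a] t_sym[of a b] that vab by auto
  next
    case False
    then show ?thesis
      using t_side[of x y b] t_side[of b x a] t_sym[of b] that vab by auto
  qed
  define c where "c = t a b"
  define A where "A = (if c then {v} \<union> {x \<in> V. {v, x} \<in> E} else {x \<in> V. {v, x} \<in> E})"
  have no_loop: "{v, v} \<notin> E"
    using E by (auto simp: nsets_def)
  have "{x, y} \<in> E \<longleftrightarrow> ((x \<in> A \<longleftrightarrow> y \<in> A) \<longleftrightarrow> c)"
    if "x \<in> V" "y \<in> V" "x \<noteq> y" for x y
  proof -
    consider "x = v" | "y = v" | "x \<noteq> v" "y \<noteq> v"
      by blast
    then show ?thesis
    proof cases
      case 3
      then have "t x y \<longleftrightarrow> c"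
        using that t_const by (auto simp: c_def)
      then show ?thesis
        using that 3 by (auto simp: A_def t_def)
    qed (use that no_loop in \<open>auto simp: A_def insert_commute\<close>)
  qed
  moreover have "A \<subseteq> V"
    using vab by (auto simp: A_def)
  ultimately show thesis
    using that by blast
qed

section \<open>Two cliques\<close>

text \<open>
  The condition on \<open>k\<close> comes from comparing a \<open>k\<close>-set inside the large part with one that has a
  single vertex in the other part: both \<open>k choose 2\<close> and \<open>(k-1) choose 2\<close> must be odd.
\<close>
lemma odd_two_cliques:
  assumes E: "E \<subseteq> [V]\<^bsup>2\<^esup>" and k: "k \<ge> 2"
    and odd: "\<not> has_even_induced_subgraph V E k"
    and large: "L \<subseteq> V" "k \<le> card L" and cliqueL: "complete_graph L (induced_edges E L)"
    and cliqueM: "complete_graph (V - L) (induced_edges E (V - L))"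
    and cross: "\<And>a b. a \<in> L \<Longrightarrow> b \<in> V - L \<Longrightarrow> {a, b} \<notin> E"
  shows "odd (k choose 2) \<and>
    (complete_graph V E \<or> (k mod 4 = 3 \<and> disjoint_union_of_two_cliques V E))"
proof -
  obtain P where P: "P \<subseteq> L" "card P = k"
    using large obtain_subset_with_card_n by metis
  then have "card (induced_edges E P) = k choose 2"
    using card_induced_edges_clique[OF cliqueL] by simp
  then have odd_k: "odd (k choose 2)"
    using no_even_induced_subgraphD[OF odd _ P(2)] P(1) large(1) by simp
  show ?thesis
  proof (cases "L = V")
    case True
    have "induced_edges E V = E"
      using E by (auto simp: induced_edges_def nsets_def)
    then show ?thesis
      using odd_k cliqueL True by simp
  next
    case False
    then obtain m where m: "m \<in> V - L"
      using large by blast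
    have "k - 1 \<le> card L"
      using large by simp
    then obtain Q where Q: "Q \<subseteq> L" "card Q = k - 1" "finite Q"
      by (rule obtain_subset_with_card_n)
    have "card (induced_edges E (Q \<union> {m})) = (k - 1) choose 2"
      using card_induced_edges_two_cliques[OF E cliqueL Q(1,3) cliqueM _ _ _ cross, of "{m}"] m Q(2)
      by (simp add: binomial_eq_0)
    moreover have "card (Q \<union> {m}) = k"
      using Q m k by (subst card_Un_disjoint) auto
    moreover have "Q \<union> {m} \<subseteq> V"
      using Q m large by auto
    ultimately have "odd ((k - 1) choose 2)"
      using no_even_induced_subgraphD[OF odd, of "Q \<union> {m}"] by simp
    moreover have "k choose 2 = ((k - 1) choose 2) + (k - 1)"
      using choose_two_add[of "k - 1" 1] k by (simp add: binomial_eq_0)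
    ultimately have "even (k - 1)"
      using odd_k by simp
    then have "odd k"
      using k by simp
    then obtain j where j: "k = 2 * j + 1"
      by (rule oddE)
    then have "k choose 2 = j * (2 * j + 1)"
      by (simp add: choose_two)
    then have "odd j"
      using odd_k by simp
    then have "k mod 4 = 3"
      using j by presburger
    moreover have "disjoint_union_of_two_cliques V E"
      unfolding disjoint_union_of_two_cliques_def
      using large cliqueL cliqueM cross by - (rule exI[of _ L], rule exI[of _ "V - L"], auto)
    ultimately show ?thesis
      using odd_k by blast
  qed
qed

text \<open>
  The \<open>p * q\<close> pairs that a \<open>k\<close>-set loses by being split between the two cliques are even in
  number, because two numbers with odd sum have an even product.
\<close>
lemma two_cliques_odd:
  assumes E: "E \<subseteq> [V]\<^bsup>2\<^esup>" and V: "finite V"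
    and k: "odd k" "odd (k choose 2)" and cliques: "disjoint_union_of_two_cliques V E"
  shows "\<not> has_even_induced_subgraph V E k"
proof
  assume "has_even_induced_subgraph V E k"
  then obtain U where U: "U \<subseteq> V" "card U = k" "even (card (induced_edges E U))"
    by (auto simp: has_even_induced_subgraph_def)
  obtain A B where AB: "A \<union> B = V" "A \<inter> B = {}"
      "complete_graph A (induced_edges E A)" "complete_graph B (induced_edges E B)"
      "\<And>a b. a \<in> A \<Longrightarrow> b \<in> B \<Longrightarrow> {a, b} \<notin> E"
    using cliques unfolding disjoint_union_of_two_cliques_def by blast
  let ?p = "card (U \<inter> A)" and ?q = "card (U \<inter> B)"
  have fin: "finite (U \<inter> A)" "finite (U \<inter> B)"
    using U V by (auto intro: finite_subset)
  have UAB: "(U \<inter> A) \<union> (U \<inter> B) = U"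
    using U AB by blast
  have "card (induced_edges E U) = (?p choose 2) + (?q choose 2)"
    using card_induced_edges_two_cliques[OF E AB(3) _ fin(1) AB(4) _ fin(2) AB(2,5)]
    by (simp add: UAB)
  moreover have sum: "k = ?p + ?q"
    using card_Un_disjoint[OF fin] AB(2) U(2) UAB by auto
  ultimately have "k choose 2 = card (induced_edges E U) + ?p * ?q"
    by (metis choose_two_add)
  moreover have "even (?p * ?q)"
    using k(1) sum by auto
  ultimately show False
    using U(3) k(2) by simp
qed

section \<open>The characterisation\<close>

lemma no_even_induced_subgraph_iff:
  assumes E: "E \<subseteq> [V]\<^bsup>2\<^esup>" and V: "finite V" "card V \<ge> 2 * k" and k: "k \<ge> 2"
  shows "\<not> has_even_induced_subgraph V E k \<longleftrightarrow>
    odd (k choose 2) \<and>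
    (complete_graph V E \<or> (k mod 4 = 3 \<and> disjoint_union_of_two_cliques V E))"
proof
  assume odd: "\<not> has_even_induced_subgraph V E k"
  have "card V \<ge> k + 2"
    using V k by simp
  then obtain A c where A: "A \<subseteq> V"
    "\<And>x y. x \<in> V \<Longrightarrow> y \<in> V \<Longrightarrow> x \<noteq> y \<Longrightarrow> {x, y} \<in> E \<longleftrightarrow> ((x \<in> A \<longleftrightarrow> y \<in> A) \<longleftrightarrow> c)"
    using dichotomy[OF E V(1) _ k odd] by metis
  have "card A + card (V - A) = card V"
    using A V by (metis card_Diff_subset card_mono finite_subset le_add_diff_inverse)
  then have "k \<le> card A \<or> k \<le> card (V - A)"
    using V by linarith
  then obtain L where L: "L \<subseteq> V" "k \<le> card L" "L = A \<or> L = V - A"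
    using A by blast
  have adj: "{x, y} \<in> E \<longleftrightarrow> ((x \<in> L \<longleftrightarrow> y \<in> L) \<longleftrightarrow> c)" if "x \<in> V" "y \<in> V" "x \<noteq> y" for x y
    using L(3) A(2)[OF that] that by auto
  show "odd (k choose 2) \<and>
    (complete_graph V E \<or> (k mod 4 = 3 \<and> disjoint_union_of_two_cliques V E))"
  proof (cases c)
    case True
    have clique: "complete_graph K (induced_edges E K)"
      if K: "K \<subseteq> V" "\<And>x y. x \<in> K \<Longrightarrow> y \<in> K \<Longrightarrow> (x \<in> L \<longleftrightarrow> y \<in> L)" for K
    proof -
      have "e \<in> E" if e: "e \<in> [K]\<^bsup>2\<^esup>" for e
      proof -
        obtain x y where "e = {x, y}" "x \<noteq> y" "x \<in> K" "y \<in> K"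
          using e by (auto simp: nsets_def card_2_iff)
        then show ?thesis
          using adj[of x y] True K(1) K(2)[of x y] by auto
      qed
      then show ?thesis
        using E by (auto simp: complete_graph_def induced_edges_def nsets_def)
    qed
    have "{a, b} \<notin> E" if "a \<in> L" "b \<in> V - L" for a b
      using that L(1) adj[of a b] True by auto
    moreover have "complete_graph L (induced_edges E L)"
      "complete_graph (V - L) (induced_edges E (V - L))"
      using L(1) by (auto intro!: clique)
    ultimately show ?thesis
      using L by (intro odd_two_cliques[OF E k odd, of L])
  next
    case False
    obtain U where U: "U \<subseteq> L" "card U = k"
      using L obtain_subset_with_card_n by metis
    have "e \<notin> induced_edges E U" for e
    proof
      assume "e \<in> induced_edges E U"
      then have e: "e \<in> E" "e \<subseteq> U"
        by (auto simp: induced_edges_def)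
      then obtain x y where "e = {x, y}" "x \<noteq> y"
        using E by (auto simp: nsets_def card_2_iff)
      then show False
        using e U L(1) adj[of x y] False by auto
    qed
    then have "induced_edges E U = {}"
      by blast
    then show ?thesis
      using no_even_induced_subgraphD[OF odd _ U(2)] U(1) L(1) by auto
  qed
next
  assume rhs: "odd (k choose 2) \<and>
    (complete_graph V E \<or> (k mod 4 = 3 \<and> disjoint_union_of_two_cliques V E))"
  show "\<not> has_even_induced_subgraph V E k"
  proof (cases "complete_graph V E")
    case True
    have "induced_edges E V = E"
      using E by (auto simp: induced_edges_def nsets_def)
    then show ?thesis
      using True rhs card_induced_edges_clique[of V E]
      by (auto simp: has_even_induced_subgraph_def)
  next
    case False
    then have "k mod 4 = 3"
      using rhs by blast
    then have "odd k"
      by presburger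
    then show ?thesis
      using two_cliques_odd[OF E V(1)] rhs False by blast
  qed
qed

theorem corollary3p7:
  fixes V :: "'a set" and E :: "'a set set" and k n :: nat
  assumes "k \<ge> 2"
    and "finite_simple_graph V E"
    and "card V = n"
    and "n \<ge> 2 ^ (2 * k)"
  shows "\<not> has_even_induced_subgraph V E k \<longleftrightarrow>
    odd (k choose 2) \<and>
    (complete_graph V E \<or> (k mod 4 = 3 \<and> disjoint_union_of_two_cliques V E))"
proof (rule no_even_induced_subgraph_iff)
  show "card V \<ge> 2 * k"
    using assms(3,4) less_exp[of "2 * k"] by linarith
qed (use assms in \<open>auto simp: finite_simple_graph_def\<close>)

end
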